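(* Let $K$ be a compact Hausdorff space and $X$ a normed linear space. Let $\phi,\psi\in C(K,X)$ with $\phi\neq 0$, and let $\varepsilon\in[0,1)$. Then $\phi\perp_0^\varepsilon\psi$ in $C(K,X)$ if and only if \[ \mathrm{conv}\{x^*(\psi(t)):\ t\in M_\phi,\ x^*\in S_{X^*},\ x^*(\phi(t))=\|\phi\|_\infty\}\cap B(0,\varepsilon\|\psi\|_\infty)\ne\emptyset. \]
   Context: All normed linear spaces are over $\mathbb{C}$. $C(K,X)$ is the space of continuous functions $K\to X$ with the supremum norm $\|\cdot\|_\infty$. $X^*$ is the topological dual of $X$, with unit sphere $S_{X^*}$. For $\phi\in C(K,X)$, $M_\phi=\{t\in K:\|\phi(t)\|=\|\phi\|_\infty\}$. $\mathrm{conv}$ denotes the convex hull in $\mathbb{C}$, and $B(0,r)=\{z\in\mathbb{C}:|z|\le r\}$ for $r\ge0$ (so $B(0,0)=\{0\}$). For a normed linear space $Z$, $\varepsilon\in[0,1)$ and $u,v\in Z$, one writes $u\perp_0^\varepsilon v$ if there exists $f\in Z^*\setminus\{0\}$ with $|f(u)|\ge\|f\|\|u\|$ and $|f(v)|\le\varepsilon\|f\|\|v\|$. *)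

theory Defs
  imports "HOL-Analysis.Analysis"
begin

text \<open>
  A complex normed space is a real normed space together with a complex scalar
  multiplication that extends the real one and with respect to which the norm is homogeneous.
\<close>

class complex_normed_vector = real_normed_vector +
  fixes scaleC :: "complex \<Rightarrow> 'a \<Rightarrow> 'a" (infixr "*\<^sub>C" 75)
  assumes scaleC_add_right: "a *\<^sub>C (x + y) = a *\<^sub>C x + a *\<^sub>C y"
    and scaleC_add_left: "(a + b) *\<^sub>C x = a *\<^sub>C x + b *\<^sub>C x"
    and scaleC_scaleC: "a *\<^sub>C b *\<^sub>C x = (a * b) *\<^sub>C x"
    and scaleC_of_real: "complex_of_real r *\<^sub>C x = r *\<^sub>R x"
    and norm_scaleC: "norm (a *\<^sub>C x) = cmod a * norm x"

instantiation complex :: complex_normed_vector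
begin

definition scaleC_complex :: "complex \<Rightarrow> complex \<Rightarrow> complex"
  where "scaleC_complex a x = a * x"

instance
  by standard (auto simp: scaleC_complex_def algebra_simps norm_mult scaleR_conv_of_real)

end

lemma bounded_linear_scaleC:
  "bounded_linear (\<lambda>x :: 'a::complex_normed_vector. a *\<^sub>C x)"
proof (rule bounded_linear_intro[where K = "cmod a"])
  fix r and x :: 'a
  show "a *\<^sub>C r *\<^sub>R x = r *\<^sub>R a *\<^sub>C x"
    by (metis mult.commute scaleC_of_real scaleC_scaleC)
qed (simp_all add: scaleC_add_right norm_scaleC mult.commute)

text \<open>
  For a compact Hausdorff space $K$, represented by a type of class \<^class>\<open>t2_space\<close> with
  compact universe, \<open>'k \<Rightarrow>\<^sub>C 'x\<close> is $C(K,X)$: boundedness is automatic by the following lemma,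
  and the norm of this type is the supremum norm.
\<close>

lemma continuous_imp_bcontfun:
  fixes f :: "'k::topological_space \<Rightarrow> 'x::metric_space"
  assumes "compact (UNIV :: 'k set)" "continuous_on UNIV f"
  shows "f \<in> bcontfun"
  using assms by (simp add: bcontfun_def compact_continuous_image compact_imp_bounded)

lemma norm_bcontfun_eq_SUP:
  fixes f :: "'k::topological_space \<Rightarrow>\<^sub>C 'x::real_normed_vector"
  shows "norm f = (SUP t. norm (f t))"
  by (simp add: norm_bcontfun_def dist_bcontfun.rep_eq)

lemma scaleC_bcontfun_closed:
  fixes f :: "'k::topological_space \<Rightarrow>\<^sub>C 'x::complex_normed_vector"
  shows "(\<lambda>t. a *\<^sub>C f t) \<in> bcontfun"
proof (rule bcontfun_normI)
  show "continuous_on UNIV (\<lambda>t. a *\<^sub>C f t)"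
    by (rule bounded_linear.continuous_on[OF bounded_linear_scaleC]) simp
  show "norm (a *\<^sub>C f t) \<le> cmod a * norm f" for t
    by (simp add: norm_scaleC mult_left_mono norm_bounded)
qed

instantiation bcontfun :: (topological_space, complex_normed_vector) complex_normed_vector
begin

definition scaleC_bcontfun :: "complex \<Rightarrow> ('a \<Rightarrow>\<^sub>C 'b) \<Rightarrow> 'a \<Rightarrow>\<^sub>C 'b"
  where "scaleC_bcontfun a f = Bcontfun (\<lambda>t. a *\<^sub>C f t)"

lemma apply_scaleC_bcontfun [simp]:
  "apply_bcontfun (a *\<^sub>C f) t = a *\<^sub>C f t" for f :: "'a \<Rightarrow>\<^sub>C 'b"
  by (simp add: scaleC_bcontfun_def Bcontfun_inverse scaleC_bcontfun_closed)

instance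
proof
  fix a b :: complex and r :: real and f g :: "'a \<Rightarrow>\<^sub>C 'b"
  show "a *\<^sub>C (f + g) = a *\<^sub>C f + a *\<^sub>C g"
    and "(a + b) *\<^sub>C f = a *\<^sub>C f + b *\<^sub>C f"
    and "a *\<^sub>C b *\<^sub>C f = (a * b) *\<^sub>C f"
    and "complex_of_real r *\<^sub>C f = r *\<^sub>R f"
    by (rule bcontfun_eqI,
        simp add: scaleC_add_right scaleC_add_left scaleC_scaleC scaleC_of_real)+
  have le: "norm (c *\<^sub>C h) \<le> cmod c * norm h" for c and h :: "'a \<Rightarrow>\<^sub>C 'b"
    by (rule norm_bound) (simp add: norm_scaleC mult_left_mono norm_bounded)
  show "norm (a *\<^sub>C f) = cmod a * norm f"
  proof (cases "a = 0")
    case True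
    then show ?thesis using le[of a f] by simp
  next
    case False
    then have "inverse a *\<^sub>C a *\<^sub>C f = f"
      by (intro bcontfun_eqI) (simp add: scaleC_scaleC scaleC_of_real[of 1, simplified])
    then have "norm f \<le> cmod (inverse a) * norm (a *\<^sub>C f)"
      using le[of "inverse a" "a *\<^sub>C f"] by simp
    then show ?thesis
      using le[of a f] False by (simp add: norm_inverse norm_divide field_simps)
  qed
qed

end

text \<open>The topological dual; the dual norm is \<^const>\<open>onorm\<close>.\<close>

definition cdual :: "('a::complex_normed_vector \<Rightarrow> complex) set"
  where "cdual = {f. bounded_linear f \<and> (\<forall>c x. f (c *\<^sub>C x) = c * f x)}"

definition dual_sphere :: "('a::complex_normed_vector \<Rightarrow> complex) set"
  where "dual_sphere = {f \<in> cdual. onorm f = 1}"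

definition approx_orthogonal :: "real \<Rightarrow> 'a::complex_normed_vector \<Rightarrow> 'a \<Rightarrow> bool"
  where "approx_orthogonal \<epsilon> u v \<longleftrightarrow>
    (\<exists>f \<in> cdual. f \<noteq> (\<lambda>x. 0) \<and> cmod (f u) \<ge> onorm f * norm u
      \<and> cmod (f v) \<le> \<epsilon> * onorm f * norm v)"

definition norm_attainment_set :: "('k::topological_space \<Rightarrow>\<^sub>C 'x::real_normed_vector) \<Rightarrow> 'k set"
  where "norm_attainment_set \<phi> = {t. norm (\<phi> t) = norm \<phi>}"

end

theory Submission
  imports Defs
begin

text \<open>
  After normalising and rotating the functional, approximate orthogonality of $\phi \neq 0$ to
  $\psi$ says that some $F$ in the unit ball of $C(K,X)^*$ satisfies $F(\phi) = \|\phi\|$ and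
  $|F(\psi)| \le \varepsilon\|\psi\|$ (\<open>approx_orthogonal_iff_dual_ball\<close>). So it suffices to
  identify the set $V$ of all values $F(\psi)$ of such support functionals with the convex hull
  of the set $S$ of values $x^*(\psi(t))$ in the theorem. This is \<open>convex_hull_norming_values\<close>.

  Each $x^*(\psi(t))$ in $S$ is a value in $V$, of the functional $h \mapsto x^*(h(t))$, and $V$
  is convex; this gives one inclusion. For the other, suppose that $F(\psi)$ is outside the hull.
  The set $S$ is compact (\<open>compact_norming_values\<close>), hence so is its hull, and a line separates
  $F(\psi)$ from it: for some complex $c$, $\mathrm{Re}(c z) < \mathrm{Re}(c F(\psi))$ for all
  $z \in S$. But with $a = \mathrm{Re}(c F(\psi))$ the functional $F$ shows that
  $\|\phi + r c\psi\| \ge \|\phi\| + r a$ for all $r \ge 0$. Compactness of $K$ and convexity of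
  the norm yield a single point $t$ at which this growth takes place
  (\<open>norm_growth_localizes\<close>), and a Hahn--Banach argument in $X$ then produces an $x^*$ that
  supports $\phi(t)$ and has $\mathrm{Re}(c\, x^*(\psi(t))) \ge a$, a contradiction
  (\<open>norming_value_above\<close>).

  The Hahn--Banach theorem is used in the form of Mazur and Orlicz: a sublinear functional $p$
  dominates a linear $g$ with $g(v) \ge a$ for all $(v,a)$ in a convex cone $T$, as soon as
  $p(v) \ge a$ on $T$. Prescribing lower bounds on a cone covers both applications:
  the half-plane condition above, where only inequalities are known, and the compactness of $S$.
  The latter rests on describing $S$ without functionals, by closed conditions on $(t,z)$ that say
  that $x^*$ can be defined consistently on the span of $\phi(t)$ and $\psi(t)$
  (\<open>mem_norming_values_iff\<close>).
\<close>

section \<open>Sublinear functionals and the Mazur--Orlicz theorem\<close>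

text \<open>
  Positive homogeneity is required only as an inequality, which is less to verify for the
  infima constructed below; equality follows.
\<close>

definition sublinear :: "('a::real_vector \<Rightarrow> real) \<Rightarrow> bool"
  where "sublinear p \<longleftrightarrow>
    (\<forall>x y. p (x + y) \<le> p x + p y) \<and> (\<forall>r x. 0 \<le> r \<longrightarrow> p (r *\<^sub>R x) \<le> r * p x)"

lemma sublinear_add: "sublinear p \<Longrightarrow> p (x + y) \<le> p x + p y"
  and sublinear_scaleR_le: "sublinear p \<Longrightarrow> 0 \<le> r \<Longrightarrow> p (r *\<^sub>R x) \<le> r * p x"
  by (auto simp: sublinear_def)

lemma sublinear_zero: "sublinear p \<Longrightarrow> p 0 = 0"
  using sublinear_add[of p 0 0] sublinear_scaleR_le[of p 0 0] by simp

lemma sublinear_scaleR: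
  assumes p: "sublinear p" and r: "0 \<le> r"
  shows "p (r *\<^sub>R x) = r * p x"
proof (cases "r = 0")
  case False
  have "p x \<le> inverse r * p (r *\<^sub>R x)"
    using sublinear_scaleR_le[OF p, of "inverse r" "r *\<^sub>R x"] r False by simp
  then show ?thesis
    using sublinear_scaleR_le[OF p r, of x] r False by (simp add: field_simps)
qed (simp add: sublinear_zero[OF p])

lemma sublinear_minus_le: "sublinear p \<Longrightarrow> - p (- x) \<le> p x"
  using sublinear_add[of p x "- x"] sublinear_zero[of p] by simp

lemma sublinear_norm: "sublinear norm"
  by (simp add: sublinear_def norm_triangle_ineq)

text \<open>
  The greatest sublinear functional that is at most \<open>p\<close> and for which every linear functional
  \<open>g\<close> below it satisfies $g(v) \ge a$ for $(v,a) \in T$: the inequality $g \le p$ at $y + v$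
  and $g(v) \ge a$ force $g(y) \le p(y + v) - a$.
\<close>

definition cone_shift :: "('a \<times> real) set \<Rightarrow> ('a::real_vector \<Rightarrow> real) \<Rightarrow> 'a \<Rightarrow> real"
  where "cone_shift T p y = (INF (v, a)\<in>T. p (y + v) - a)"

definition dominated_cone :: "('a::real_vector \<Rightarrow> real) \<Rightarrow> ('a \<times> real) set \<Rightarrow> bool"
  where "dominated_cone p T \<longleftrightarrow> convex_cone T \<and> (\<forall>(v, a)\<in>T. a \<le> p v)"

text \<open>
  Domination keeps the infimum finite: $p(y + v) \ge p(v) - p(-y) \ge a - p(-y)$.
\<close>

lemma
  assumes p: "sublinear p" and T: "dominated_cone p T"
  shows cone_shift_le: "(v, a) \<in> T \<Longrightarrow> cone_shift T p y \<le> p (y + v) - a"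
    and cone_shift_greatest:
      "(\<And>v a. (v, a) \<in> T \<Longrightarrow> c \<le> p (y + v) - a) \<Longrightarrow> c \<le> cone_shift T p y"
proof -
  have lower: "- p (- y) \<le> p (y + v) - a" if "(v, a) \<in> T" for v a
    using sublinear_add[OF p, of "y + v" "- y"] T that by (force simp: dominated_cone_def)
  show "cone_shift T p y \<le> p (y + v) - a" if "(v, a) \<in> T"
    unfolding cone_shift_def
    by (rule cINF_lower2[OF _ that]) (use lower in \<open>auto intro!: bdd_belowI[of _ "- p (- y)"]\<close>)
  show "c \<le> cone_shift T p y" if "\<And>v a. (v, a) \<in> T \<Longrightarrow> c \<le> p (y + v) - a"
    unfolding cone_shift_def
    using that T by (intro cINF_greatest) (auto simp: dominated_cone_def convex_cone_def)
qed

lemma sublinear_cone_shift: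
  assumes p: "sublinear p" and T: "dominated_cone p T"
  shows "sublinear (cone_shift T p)"
  unfolding sublinear_def
proof (intro conjI allI impI)
  note le = cone_shift_le[OF p T] and greatest = cone_shift_greatest[OF p T]
  have cone: "convex_cone T" using T by (simp add: dominated_cone_def)
  fix x y
  have "cone_shift T p (x + y) - (p (x + v) - a) \<le> cone_shift T p y" if va: "(v, a) \<in> T" for v a
  proof (rule greatest)
    fix w b assume wb: "(w, b) \<in> T"
    have "(v + w, a + b) \<in> T" using convex_cone_add[OF cone va wb] by simp
    from le[OF this, of "x + y"] sublinear_add[OF p, of "x + v" "y + w"]
    show "cone_shift T p (x + y) - (p (x + v) - a) \<le> p (y + w) - b"
      by (simp add: algebra_simps)
  qed
  then have "cone_shift T p (x + y) - cone_shift T p y \<le> cone_shift T p x"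
    by (intro greatest) (simp add: algebra_simps)
  then show "cone_shift T p (x + y) \<le> cone_shift T p x + cone_shift T p y" by simp
next
  note le = cone_shift_le[OF p T] and greatest = cone_shift_greatest[OF p T]
  have cone: "convex_cone T" using T by (simp add: dominated_cone_def)
  fix r :: real and x assume r: "0 \<le> r"
  have scaled: "cone_shift T p (r *\<^sub>R x) \<le> r * (p (x + v) - a)" if "(v, a) \<in> T" for v a
  proof -
    have "(r *\<^sub>R v, r * a) \<in> T" using convex_cone_scaleR[OF cone r that] by simp
    from le[OF this, of "r *\<^sub>R x"] show ?thesis
      using sublinear_scaleR[OF p r, of "x + v"] by (simp add: algebra_simps)
  qed
  show "cone_shift T p (r *\<^sub>R x) \<le> r * cone_shift T p x"
  proof (cases "r = 0")
    case True
    then show ?thesis using scaled cone by (fastforce simp: convex_cone_def)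
  next
    case False
    then have "cone_shift T p (r *\<^sub>R x) / r \<le> cone_shift T p x"
      using r scaled by (intro greatest) (simp add: field_simps)
    then show ?thesis using r False by (simp add: field_simps)
  qed
qed

lemma cone_shift_le_self:
  assumes "sublinear p" "dominated_cone p T"
  shows "cone_shift T p y \<le> p y"
proof -
  have "(0, 0) \<in> T"
    using assms convex_cone_contains_0[of T] by (auto simp: dominated_cone_def zero_prod_def)
  from cone_shift_le[OF assms this, of y] show ?thesis by simp
qed

text \<open>
  A linear \<open>g\<close> below the shifted functional therefore has $g(v) = -g(-v) \ge a$.
\<close>

lemma cone_shift_minus_le:
  assumes "sublinear p" "dominated_cone p T" "(v, a) \<in> T"
  shows "cone_shift T p (- v) \<le> - a"
  using cone_shift_le[OF assms, of "- v"] sublinear_zero[OF assms(1)] by simp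

text \<open>
  By minimality, shifting \<open>p\<close> along the ray through $(v, p(v))$ does not change it, so
  $p(-v) \le -p(v)$. Hence \<open>p\<close> is odd, and an odd sublinear functional is linear.
\<close>

lemma minimal_sublinear_imp_linear:
  assumes p: "sublinear p" and minimal: "\<And>q. sublinear q \<Longrightarrow> q \<le> p \<Longrightarrow> q = p"
  shows "linear p"
proof -
  have odd: "p (- v) = - p v" for v
  proof -
    let ?T = "(\<lambda>r. (r *\<^sub>R v, r * p v)) ` {0..}"
    have "linear (\<lambda>r. (r *\<^sub>R v, r * p v))"
      by (rule linearI) (auto simp: algebra_simps)
    moreover have "convex_cone {0::real..}"
      by (auto simp: convex_cone_iff)
    ultimately have "convex_cone ?T"
      using convex_cone_linear_image by blast
    then have T: "dominated_cone p ?T"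
      by (auto simp: dominated_cone_def sublinear_scaleR[OF p])
    have "cone_shift ?T p = p"
      by (rule minimal) (auto simp: le_fun_def sublinear_cone_shift[OF p T] cone_shift_le_self[OF p T])
    moreover have "cone_shift ?T p (- v) \<le> - p v"
      by (rule cone_shift_minus_le[OF p T]) (auto intro: image_eqI[of _ _ 1])
    ultimately show ?thesis
      using sublinear_minus_le[OF p, of v] by simp
  qed
  show ?thesis
  proof (rule linearI)
    fix x y
    have "- p (x + y) \<le> - p x - p y"
      using sublinear_add[OF p, of "- x" "- y"] odd[of "x + y"] odd[of x] odd[of y] by simp
    then show "p (x + y) = p x + p y"
      using sublinear_add[OF p, of x y] by simp
  next
    fix r x
    show "p (r *\<^sub>R x) = r *\<^sub>R p x"
      using sublinear_scaleR[OF p, of r x] sublinear_scaleR[OF p, of "- r" x] odd[of "r *\<^sub>R x"]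
      by (cases "0 \<le> r") auto
  qed
qed

text \<open>
  By Zorn's lemma there is a minimal sublinear functional below \<open>p\<close>. The pointwise infimum of a
  chain is again sublinear: for subadditivity, two members of the chain have a common lower
  bound in it, and $-p(-y)$ bounds all values at $y$ from below.
\<close>

lemma linear_below_sublinear:
  assumes p: "sublinear p"
  obtains g where "linear g" "\<And>x. g x \<le> p x"
proof -
  define A where "A = {q. sublinear q \<and> q \<le> p}"
  have "\<exists>m\<in>A. \<forall>q\<in>A. m \<ge> q \<longrightarrow> q = m"
  proof (rule predicate_Zorn)
    show "partial_order_on A (relation_of (\<ge>) A)"
      by (rule partial_order_on_relation_ofI) auto
  next
    fix C assume C: "C \<in> Chains (relation_of (\<ge>) A)"
    then have CA: "sublinear f" "f \<le> p" if "f \<in> C" for f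
      using that by (auto simp: Chains_def relation_of_def A_def)
    have total: "f \<le> h \<or> h \<le> f" if "f \<in> C" "h \<in> C" for f h
      using C that by (auto simp: Chains_def relation_of_def)
    show "\<exists>u\<in>A. \<forall>f\<in>C. f \<ge> u"
    proof (cases "C = {}")
      case True
      then show ?thesis using p by (auto simp: A_def)
    next
      case False
      define u where "u y = (INF f\<in>C. f y)" for y
      have bdd: "bdd_below ((\<lambda>f. f y) ` C)" for y
      proof (rule bdd_belowI2)
        fix f assume f: "f \<in> C"
        show "- p (- y) \<le> f y"
          using sublinear_minus_le[OF CA(1)[OF f], of y] le_funD[OF CA(2)[OF f], of "- y"] by linarith
      qed
      have le: "u y \<le> f y" if "f \<in> C" for f y
        unfolding u_def using bdd that by (rule cINF_lower)
      have greatest: "c \<le> u y" if "\<And>f. f \<in> C \<Longrightarrow> c \<le> f y" for c y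
        unfolding u_def using False that by (rule cINF_greatest)
      have "sublinear u"
        unfolding sublinear_def
      proof (intro conjI allI impI)
        fix x y
        have "u (x + y) - f x \<le> h y" if f: "f \<in> C" and h: "h \<in> C" for f h
        proof -
          have "\<exists>k\<in>C. k \<le> f \<and> k \<le> h" using total[OF f h] f h by blast
          then obtain k where k: "k \<in> C" "k \<le> f" "k \<le> h" by blast
          have "u (x + y) \<le> k x + k y"
            using le[OF k(1), of "x + y"] sublinear_add[OF CA(1)[OF k(1)], of x y] by simp
          then show ?thesis using le_funD[OF k(2), of x] le_funD[OF k(3), of y] by simp
        qed
        then have "u (x + y) - f x \<le> u y" if "f \<in> C" for f using that greatest by blast
        then have "u (x + y) - u y \<le> u x" by (intro greatest) (simp add: algebra_simps)
        then show "u (x + y) \<le> u x + u y" by simp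
      next
        fix r :: real and x assume r: "0 \<le> r"
        have scaled: "u (r *\<^sub>R x) \<le> r * f x" if "f \<in> C" for f
          using le[OF that, of "r *\<^sub>R x"] sublinear_scaleR[OF CA(1)[OF that] r, of x] by simp
        show "u (r *\<^sub>R x) \<le> r * u x"
        proof (cases "r = 0")
          case True
          then show ?thesis using scaled False by fastforce
        next
          case False
          then have "u (r *\<^sub>R x) / r \<le> u x"
            using r scaled by (intro greatest) (simp add: field_simps)
          then show ?thesis using r False by (simp add: field_simps)
        qed
      qed
      moreover have "u \<le> p"
        using False le CA(2) by (fastforce simp: le_fun_def intro: order_trans)
      ultimately show ?thesis using le by (auto simp: A_def le_fun_def)
    qed
  qed
  then obtain m where m: "sublinear m" "m \<le> p" "\<And>q. sublinear q \<Longrightarrow> q \<le> m \<Longrightarrow> q = m"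
    unfolding A_def by (blast intro: order_trans)
  show ?thesis
    using that[OF minimal_sublinear_imp_linear[OF m(1,3)]] m(2) by (simp add: le_fun_def)
qed

lemma Mazur_Orlicz:
  assumes p: "sublinear p" and T: "dominated_cone p T"
  obtains g where "linear g" "\<And>x. g x \<le> p x" "\<And>v a. (v, a) \<in> T \<Longrightarrow> a \<le> g v"
proof -
  obtain g where g: "linear g" "\<And>x. g x \<le> cone_shift T p x"
    using linear_below_sublinear[OF sublinear_cone_shift[OF p T]] by blast
  have "g x \<le> p x" for x
    using g(2) cone_shift_le_self[OF p T] by (rule order_trans)
  moreover have "a \<le> g v" if "(v, a) \<in> T" for v a
    using g(2)[of "- v"] cone_shift_minus_le[OF p T that] linear_neg[OF g(1), of v] by linarith
  ultimately show ?thesis using that g(1) by blast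
qed


section \<open>Complex functionals with prescribed lower bounds\<close>

lemma scaleC_one [simp]: "1 *\<^sub>C x = (x::'a::complex_normed_vector)"
  using scaleC_of_real[of 1 x] by simp

lemma scaleR_scaleC: "r *\<^sub>R a *\<^sub>C x = (complex_of_real r * a) *\<^sub>C (x::'a::complex_normed_vector)"
  by (simp add: scaleC_of_real[symmetric] scaleC_scaleC)

lemma cnj_sgn_mult_self: "cnj (sgn z) * z = complex_of_real (cmod z)"
  using complex_norm_square[of z]
  by (cases "z = 0") (simp_all add: sgn_eq power2_eq_square divide_eq_eq mult.commute)

text \<open>
  The bound is pointwise, rather than on \<^const>\<open>onorm\<close>, so that membership is a conjunction of
  inequalities between values.
\<close>

definition dual_ball :: "('a::complex_normed_vector \<Rightarrow> complex) set"
  where "dual_ball = {f \<in> cdual. \<forall>x. cmod (f x) \<le> norm x}"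

lemma dual_sphere_subset_dual_ball: "dual_sphere \<subseteq> dual_ball"
  using onorm by (fastforce simp: dual_sphere_def dual_ball_def cdual_def)

lemma dual_ball_add: "f \<in> dual_ball \<Longrightarrow> f (x + y) = f x + f y"
  and dual_ball_scaleC: "f \<in> dual_ball \<Longrightarrow> f (c *\<^sub>C x) = c * f x"
  and dual_ball_norm_le: "f \<in> dual_ball \<Longrightarrow> cmod (f x) \<le> norm x"
  by (auto simp: dual_ball_def cdual_def linear_add bounded_linear.linear)

lemma onorm_norming:
  assumes f: "f \<in> dual_ball" and u: "u \<noteq> 0" "f u = complex_of_real (norm u)"
  shows "onorm f = 1"
proof (rule antisym)
  show "onorm f \<le> 1"
    using dual_ball_norm_le[OF f] by (intro onorm_bound) auto
  show "1 \<le> onorm f"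
    using le_onorm[of f u] f u by (simp add: dual_ball_def cdual_def)
qed

lemma convex_dual_ball_norming_values:
  "convex {f v | f. f \<in> dual_ball \<and> f u = complex_of_real (norm u)}"
proof (rule convexI)
  fix x y and s t :: real
  assume st: "0 \<le> s" "0 \<le> t" "s + t = 1"
  assume "x \<in> {f v | f. f \<in> dual_ball \<and> f u = complex_of_real (norm u)}"
    and "y \<in> {f v | f. f \<in> dual_ball \<and> f u = complex_of_real (norm u)}"
  then obtain f g where f: "f \<in> dual_ball" "f u = complex_of_real (norm u)" "x = f v"
    and g: "g \<in> dual_ball" "g u = complex_of_real (norm u)" "y = g v" by blast
  define h where "h z = s *\<^sub>R f z + t *\<^sub>R g z" for z
  have "bounded_linear h"
    using f(1) g(1) unfolding h_def dual_ball_def cdual_def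
    by (auto intro!: bounded_linear_add bounded_linear_const_scaleR)
  moreover have "h (c *\<^sub>C z) = c * h z" for c z
    using f(1) g(1) by (simp add: h_def dual_ball_scaleC algebra_simps)
  moreover have "cmod (h z) \<le> norm z" for z
  proof -
    have "cmod (h z) \<le> s * cmod (f z) + t * cmod (g z)"
      unfolding h_def using norm_triangle_ineq[of "s *\<^sub>R f z" "t *\<^sub>R g z"] st by simp
    also have "\<dots> \<le> s * norm z + t * norm z"
      using st f(1) g(1) by (intro add_mono mult_left_mono dual_ball_norm_le) auto
    finally show ?thesis using st by (simp add: distrib_right[symmetric])
  qed
  ultimately have "h \<in> dual_ball" by (simp add: dual_ball_def cdual_def)
  moreover have "h u = complex_of_real (norm u)"
    using f(2) g(2) st(3) by (simp add: h_def scaleR_left.add[symmetric])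
  ultimately show "s *\<^sub>R x + t *\<^sub>R y \<in> {f v | f. f \<in> dual_ball \<and> f u = complex_of_real (norm u)}"
    unfolding f(3) g(3) by (intro CollectI exI[of _ h]) (simp add: h_def)
qed

text \<open>
  A real functional \<open>g\<close> dominated by the norm is the real part of the complex functional
  $f(x) = g(x) - i\,g(ix)$; rotating $f(x)$ to the positive reals gives $|f(x)| \le \|x\|$.
\<close>

lemma dual_ball_element_above_cone:
  fixes T :: "('a::complex_normed_vector \<times> real) set"
  assumes T: "dominated_cone norm T"
  obtains f where "f \<in> dual_ball" "\<And>v a. (v, a) \<in> T \<Longrightarrow> a \<le> Re (f v)"
proof -
  obtain g where g: "linear g" "\<And>x. g x \<le> norm x" "\<And>v a. (v, a) \<in> T \<Longrightarrow> a \<le> g v"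
    using Mazur_Orlicz[OF sublinear_norm T] by blast
  define f where "f x = Complex (g x) (- g (\<i> *\<^sub>C x))" for x
  have f_add: "f (x + y) = f x + f y" for x y
    by (simp add: f_def scaleC_add_right linear_add[OF g(1)] complex_eq_iff)
  have g_scale: "g (c *\<^sub>C x) = Re c * g x + Im c * g (\<i> *\<^sub>C x)" for c x
  proof -
    have "c = complex_of_real (Re c) + complex_of_real (Im c) * \<i>"
      by (simp add: complex_eq_iff)
    then have "c *\<^sub>C x = Re c *\<^sub>R x + Im c *\<^sub>R \<i> *\<^sub>C x"
      by (metis scaleC_add_left scaleC_of_real scaleC_scaleC)
    then show ?thesis by (simp add: linear_add[OF g(1)] linear_scale[OF g(1)])
  qed
  have f_scale: "f (c *\<^sub>C x) = c * f x" for c x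
    using g_scale[of c x] g_scale[of "\<i> * c" x]
    by (simp add: f_def scaleC_scaleC complex_eq_iff)
  have f_le: "cmod (f x) \<le> norm x" for x
  proof -
    define c where "c = cnj (sgn (f x))"
    have "cmod (f x) = Re (c * f x)"
      by (simp only: c_def cnj_sgn_mult_self Re_complex_of_real)
    also have "\<dots> = g (c *\<^sub>C x)" by (simp add: f_scale[symmetric]) (simp add: f_def)
    also have "\<dots> \<le> cmod c * norm x" using g(2)[of "c *\<^sub>C x"] by (simp add: norm_scaleC)
    also have "\<dots> \<le> norm x" by (simp add: c_def norm_sgn)
    finally show ?thesis .
  qed
  have "bounded_linear f"
    using f_add f_scale[of "complex_of_real _"] f_le
    by (intro bounded_linear_intro[where K = 1]) (auto simp: scaleC_of_real scaleR_conv_of_real)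
  then have "f \<in> dual_ball" using f_scale f_le by (simp add: dual_ball_def cdual_def)
  then show ?thesis using that g(3) by (simp add: f_def)
qed


section \<open>The set of norming values\<close>

definition norming_values ::
    "('k::topological_space \<Rightarrow>\<^sub>C 'x::complex_normed_vector) \<Rightarrow> ('k \<Rightarrow>\<^sub>C 'x) \<Rightarrow> complex set"
  where "norming_values \<phi> \<psi> = {xs (\<psi> t) | t xs. t \<in> norm_attainment_set \<phi> \<and>
    xs \<in> dual_sphere \<and> xs (\<phi> t) = complex_of_real (norm \<phi>)}"

text \<open>
  The bounds $\mathrm{Re} f(\phi(t)) \ge \|\phi\|$ and $|f(\phi(t))| \le \|\phi\|$ leave no room
  for an imaginary part, and $\phi(t) \neq 0$ forces the dual norm of \<open>f\<close> to be exactly $1$.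
\<close>

lemma norming_valueI:
  fixes \<phi> \<psi> :: "'k::topological_space \<Rightarrow>\<^sub>C 'x::complex_normed_vector"
  assumes "\<phi> \<noteq> 0" "f \<in> dual_ball" "norm (\<phi> t) = norm \<phi>" "norm \<phi> \<le> Re (f (\<phi> t))"
  shows "f (\<psi> t) \<in> norming_values \<phi> \<psi>"
proof -
  have "cmod (f (\<phi> t)) \<le> norm \<phi>"
    using dual_ball_norm_le[OF assms(2), of "\<phi> t"] assms(3) by simp
  then have "Re (f (\<phi> t)) = norm \<phi>" and "cmod (f (\<phi> t)) = norm \<phi>"
    using complex_Re_le_cmod[of "f (\<phi> t)"] assms(4) by auto
  then have eq: "f (\<phi> t) = complex_of_real (norm \<phi>)"
    using cmod_power2[of "f (\<phi> t)"] by (simp add: complex_eq_iff)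
  have "\<phi> t \<noteq> 0" using assms(1,3) by auto
  then have "onorm f = 1"
    using onorm_norming[OF assms(2)] eq assms(3) by auto
  then show ?thesis
    using assms(2,3) eq
    unfolding norming_values_def norm_attainment_set_def dual_sphere_def dual_ball_def by blast
qed

text \<open>
  The condition says that sending $\alpha\phi(t) + \beta\psi(t)$ to $\alpha\|\phi\| + \beta z$ is
  well defined and contractive on the span of $\phi(t)$ and $\psi(t)$; a Hahn--Banach extension to
  $X$ is the required functional. For fixed $\alpha$ and $\beta$ it is closed in $(t,z)$, which is
  what compactness needs. The case $\alpha = 1$, $\beta = 0$ puts $t$ in the norm attainment set.
\<close>

lemma mem_norming_values_iff:
  fixes \<phi> \<psi> :: "'k::topological_space \<Rightarrow>\<^sub>C 'x::complex_normed_vector"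
  assumes "\<phi> \<noteq> 0"
  shows "z \<in> norming_values \<phi> \<psi> \<longleftrightarrow>
    (\<exists>t. \<forall>\<alpha> \<beta>. Re (\<alpha> * complex_of_real (norm \<phi>) + \<beta> * z) \<le> norm (\<alpha> *\<^sub>C \<phi> t + \<beta> *\<^sub>C \<psi> t))"
    (is "_ \<longleftrightarrow> (\<exists>t. ?P t)")
proof
  assume "z \<in> norming_values \<phi> \<psi>"
  then obtain t f where f: "f \<in> dual_ball" "f (\<phi> t) = complex_of_real (norm \<phi>)" "z = f (\<psi> t)"
    unfolding norming_values_def using dual_sphere_subset_dual_ball by blast
  have "?P t"
  proof (intro allI)
    fix \<alpha> \<beta>
    have "\<alpha> * complex_of_real (norm \<phi>) + \<beta> * z = f (\<alpha> *\<^sub>C \<phi> t + \<beta> *\<^sub>C \<psi> t)"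
      using f by (simp add: dual_ball_add dual_ball_scaleC)
    then show "Re (\<alpha> * complex_of_real (norm \<phi>) + \<beta> * z) \<le> norm (\<alpha> *\<^sub>C \<phi> t + \<beta> *\<^sub>C \<psi> t)"
      using complex_Re_le_cmod dual_ball_norm_le[OF f(1)] order_trans by metis
  qed
  then show "\<exists>t. ?P t" ..
next
  assume "\<exists>t. ?P t"
  then obtain t where t: "?P t" ..
  \<comment> \<open>The cone is a linear subspace, so lower bounds on it are equalities.\<close>
  define L where "L = (\<lambda>(\<alpha>, \<beta>). (\<alpha> *\<^sub>C \<phi> t + \<beta> *\<^sub>C \<psi> t,
    Re (\<alpha> * complex_of_real (norm \<phi>) + \<beta> * z)))"
  have "linear L"
    by (rule linearI)
      (auto simp: L_def scaleC_add_left scaleR_scaleC scaleC_add_right scaleR_conv_of_real algebra_simps)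
  then have "convex_cone (range L)"
    using convex_cone_linear_image[of UNIV L] by (simp add: convex_cone_iff)
  then have "dominated_cone norm (range L)"
    using t by (auto simp: dominated_cone_def L_def)
  then obtain f where f: "f \<in> dual_ball" "\<And>v a. (v, a) \<in> range L \<Longrightarrow> a \<le> Re (f v)"
    by (rule dual_ball_element_above_cone) blast
  have le: "Re (\<alpha> * complex_of_real (norm \<phi>) + \<beta> * z) \<le> Re (\<alpha> * f (\<phi> t) + \<beta> * f (\<psi> t))"
    for \<alpha> \<beta>
    using f(2)[of "\<alpha> *\<^sub>C \<phi> t + \<beta> *\<^sub>C \<psi> t"] f(1)
    by (force simp: L_def dual_ball_add dual_ball_scaleC image_iff)
  have "f (\<psi> t) = z"
    using le[of 0 1] le[of 0 "- 1"] le[of 0 \<i>] le[of 0 "- \<i>"] by (simp add: complex_eq_iff)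
  moreover have "norm (\<phi> t) = norm \<phi>"
    using t[rule_format, of 1 0] norm_bounded[of \<phi> t] scaleC_of_real[of 0 "\<psi> t"] by simp
  moreover have "norm \<phi> \<le> Re (f (\<phi> t))"
    using le[of 1 0] by simp
  ultimately show "z \<in> norming_values \<phi> \<psi>"
    using norming_valueI[OF assms f(1), of t \<psi>] by simp
qed

lemma norming_values_subset: "norming_values \<phi> \<psi> \<subseteq> cball 0 (norm \<psi>)"
proof
  fix z assume "z \<in> norming_values \<phi> \<psi>"
  then obtain f t where "f \<in> dual_ball" "z = f (\<psi> t)"
    unfolding norming_values_def using dual_sphere_subset_dual_ball by blast
  then show "z \<in> cball 0 (norm \<psi>)"
    using dual_ball_norm_le[of f "\<psi> t"] norm_bounded[of \<psi> t] by simp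
qed

text \<open>
  The set is the projection to the plane of a closed subset of the compact space
  $K \times B(0,\|\psi\|)$.
\<close>

lemma compact_norming_values:
  fixes \<phi> \<psi> :: "'k::t2_space \<Rightarrow>\<^sub>C 'x::complex_normed_vector"
  assumes K: "compact (UNIV :: 'k set)" and "\<phi> \<noteq> 0"
  shows "compact (norming_values \<phi> \<psi>)"
proof -
  define G where "G = {(t, z). \<forall>\<alpha> \<beta>.
    Re (\<alpha> * complex_of_real (norm \<phi>) + \<beta> * z) \<le> norm (\<alpha> *\<^sub>C \<phi> t + \<beta> *\<^sub>C \<psi> t)}"
  have cont: "continuous_on UNIV (\<lambda>x::'k \<times> complex. c *\<^sub>C h (fst x))"
    for c and h :: "'k \<Rightarrow>\<^sub>C 'x"
    by (rule bounded_linear.continuous_on[OF bounded_linear_scaleC])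
      (auto intro!: continuous_on_compose2[OF continuous_on_apply_bcontfun[of UNIV]] continuous_intros)
  have "closed G"
    unfolding G_def case_prod_unfold
    by (intro closed_Collect_all closed_Collect_le continuous_intros cont)
  moreover have "compact (UNIV \<times> cball 0 (norm \<psi>) :: ('k \<times> complex) set)"
    by (intro compact_Times K) auto
  ultimately have "compact (snd ` (G \<inter> UNIV \<times> cball 0 (norm \<psi>)))"
    by (intro compact_continuous_image closed_Int_compact continuous_intros)
  moreover have "norming_values \<phi> \<psi> = snd ` (G \<inter> UNIV \<times> cball 0 (norm \<psi>))"
  proof -
    have "z \<in> norming_values \<phi> \<psi> \<longleftrightarrow> (\<exists>t. (t, z) \<in> G)" for z
      by (simp add: mem_norming_values_iff[OF \<open>\<phi> \<noteq> 0\<close>] G_def)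
    then have "norming_values \<phi> \<psi> = snd ` G" by (intro set_eqI) (simp add: image_iff Bex_def)
    moreover have "snd ` G \<inter> C = snd ` (G \<inter> UNIV \<times> C)" for C by force
    ultimately show ?thesis using norming_values_subset[of \<phi> \<psi>] by (metis Int_absorb2)
  qed
  ultimately show ?thesis by simp
qed

section \<open>Support functionals and one-sided growth of the norm\<close>

text \<open>
  For each $r > 0$ the points $t$ with $\|\phi(t) + r\eta(t)\| \ge \|\phi\| + r a$ form a nonempty
  closed set. As $\|\phi(t) + r\eta(t)\|$ is convex in $r$ and at most $\|\phi\|$ for $r = 0$,
  these sets grow with $r$, so they have the finite intersection property. The case $r = 0$ of
  the conclusion, that $t$ is a norm attainment point, follows by letting $r$ tend to $0$.
\<close>

lemma norm_growth_localizes: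
  fixes \<phi> \<eta> :: "'k::t2_space \<Rightarrow>\<^sub>C 'x::real_normed_vector"
  assumes K: "compact (UNIV :: 'k set)"
    and growth: "\<And>r. 0 \<le> r \<Longrightarrow> norm \<phi> + r * a \<le> norm (\<phi> + r *\<^sub>R \<eta>)"
  obtains t where "\<And>r. 0 \<le> r \<Longrightarrow> norm \<phi> + r * a \<le> norm (\<phi> t + r *\<^sub>R \<eta> t)"
proof -
  define F where "F r = {t. norm \<phi> + r * a \<le> norm (\<phi> t + r *\<^sub>R \<eta> t)}" for r
  have cont: "continuous_on UNIV (\<lambda>t. norm (\<phi> t + r *\<^sub>R \<eta> t))" for r
    by (intro continuous_intros) auto
  have closed: "closed (F r)" for r
    unfolding F_def by (intro closed_Collect_le continuous_intros cont)
  have nonempty: "F r \<noteq> {}" if "0 \<le> r" for r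
  proof -
    obtain t where t: "\<And>s. norm (\<phi> s + r *\<^sub>R \<eta> s) \<le> norm (\<phi> t + r *\<^sub>R \<eta> t)"
      using continuous_attains_sup[OF K, of "\<lambda>t. norm (\<phi> t + r *\<^sub>R \<eta> t)"]
      using cont[of r] by auto
    have "norm (\<phi> + r *\<^sub>R \<eta>) \<le> norm (\<phi> t + r *\<^sub>R \<eta> t)"
      by (rule norm_bound) (use t in simp)
    then have "t \<in> F r" using growth[OF that] by (simp add: F_def)
    then show ?thesis by blast
  qed
  have mono: "F s \<subseteq> F r" if "0 < s" "s \<le> r" for s r
  proof
    fix t assume "t \<in> F s"
    then have "norm \<phi> + s * a \<le> norm (\<phi> t + s *\<^sub>R \<eta> t)" by (simp add: F_def)
    also have "\<phi> t + s *\<^sub>R \<eta> t = (1 - s / r) *\<^sub>R \<phi> t + (s / r) *\<^sub>R (\<phi> t + r *\<^sub>R \<eta> t)"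
      using that by (simp add: algebra_simps)
    also have "norm \<dots> \<le> (1 - s / r) * norm \<phi> + (s / r) * norm (\<phi> t + r *\<^sub>R \<eta> t)"
      using that norm_bounded[of \<phi> t]
      by (intro order_trans[OF norm_triangle_ineq] add_mono) (auto intro: mult_left_mono)
    finally have "(s / r) * (norm \<phi> + r * a) \<le> (s / r) * norm (\<phi> t + r *\<^sub>R \<eta> t)"
      using that by (simp add: algebra_simps)
    then have "norm \<phi> + r * a \<le> norm (\<phi> t + r *\<^sub>R \<eta> t)"
      by (rule mult_left_le_imp_le) (use that in simp)
    then show "t \<in> F r" by (simp add: F_def)
  qed
  have "UNIV \<inter> (\<Inter>r\<in>{0<..}. F r) \<noteq> {}"
  proof (rule compact_imp_fip_image[OF K closed])
    fix I :: "real set" assume I: "finite I" "I \<subseteq> {0<..}"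
    show "UNIV \<inter> (\<Inter>r\<in>I. F r) \<noteq> {}"
    proof (cases "I = {}")
      case False
      then have "0 < Min I" using I by auto
      then have "F (Min I) \<subseteq> (\<Inter>r\<in>I. F r)"
        using I mono by (meson INT_greatest Min_le)
      then show ?thesis using nonempty[of "Min I"] \<open>0 < Min I\<close> by auto
    qed auto
  qed
  then obtain t where "t \<in> (\<Inter>r\<in>{0<..}. F r)" by blast
  then have t: "norm \<phi> + r * a \<le> norm (\<phi> t + r *\<^sub>R \<eta> t)" if "0 < r" for r
    using that by (auto simp: F_def)
  moreover have "norm \<phi> + 0 * a \<le> norm (\<phi> t + 0 *\<^sub>R \<eta> t)"
  proof (rule tendsto_le)
    show "((\<lambda>r. norm \<phi> + r * a) \<longlongrightarrow> norm \<phi> + 0 * a) (at_right 0)"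
      and "((\<lambda>r. norm (\<phi> t + r *\<^sub>R \<eta> t)) \<longlongrightarrow> norm (\<phi> t + 0 *\<^sub>R \<eta> t)) (at_right 0)"
      by (intro tendsto_intros)+
    show "\<forall>\<^sub>F r in at_right 0. norm \<phi> + r * a \<le> norm (\<phi> t + r *\<^sub>R \<eta> t)"
      using t by (intro eventually_at_right_less[THEN eventually_mono])
  qed simp
  ultimately show ?thesis using that by (metis le_less)
qed

text \<open>
  At the point $t$ where the growth is localized, with $y = c\psi(t)$, the inequality
  $\|\phi(t) + r y\| \ge \|\phi\| + r a$ scales to
  $\|s\phi(t) + r y\| \ge s\|\phi\| + r a$ for $s, r \ge 0$. This is the domination
  needed for a functional $f$ with $\mathrm{Re} f(\phi(t)) \ge \|\phi\|$ and
  $\mathrm{Re} f(y) \ge a$.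
\<close>

lemma norming_value_above:
  fixes \<phi> \<psi> :: "'k::t2_space \<Rightarrow>\<^sub>C 'x::complex_normed_vector"
  assumes K: "compact (UNIV :: 'k set)" and "\<phi> \<noteq> 0"
    and F: "F \<in> dual_ball" "F \<phi> = complex_of_real (norm \<phi>)"
  obtains z where "z \<in> norming_values \<phi> \<psi>" "Re (c * F \<psi>) \<le> Re (c * z)"
proof -
  define a where "a = Re (c * F \<psi>)"
  have "norm \<phi> + r * a \<le> norm (\<phi> + r *\<^sub>R c *\<^sub>C \<psi>)" for r
  proof -
    have "F (\<phi> + r *\<^sub>R c *\<^sub>C \<psi>) = complex_of_real (norm \<phi>) + r *\<^sub>R (c * F \<psi>)"
      by (simp add: dual_ball_add[OF F(1)] scaleR_scaleC dual_ball_scaleC[OF F(1)] F(2)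
          scaleR_conv_of_real)
    then show ?thesis
      using complex_Re_le_cmod[of "F (\<phi> + r *\<^sub>R c *\<^sub>C \<psi>)"]
        dual_ball_norm_le[OF F(1), of "\<phi> + r *\<^sub>R c *\<^sub>C \<psi>"]
      by (simp add: a_def)
  qed
  from norm_growth_localizes[OF K this]
  obtain t where t: "\<And>r. 0 \<le> r \<Longrightarrow> norm \<phi> + r * a \<le> norm (\<phi> t + r *\<^sub>R (c *\<^sub>C \<psi>) t)"
    by blast
  define y where "y = c *\<^sub>C \<psi> t"
  have t: "norm \<phi> + r * a \<le> norm (\<phi> t + r *\<^sub>R y)" if "0 \<le> r" for r
    using t[OF that] by (simp add: y_def)
  have attains: "norm (\<phi> t) = norm \<phi>"
    using t[of 0] norm_bounded[of \<phi> t] by simp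
  define L where "L = (\<lambda>(s, r). (s *\<^sub>R \<phi> t + r *\<^sub>R y, s * norm \<phi> + r * a))"
  have "linear L"
    by (rule linearI) (auto simp: L_def algebra_simps)
  moreover have "convex_cone ({0..} \<times> {0..} :: (real \<times> real) set)"
    by (auto simp: convex_cone_iff zero_prod_def)
  ultimately have "convex_cone (L ` ({0..} \<times> {0..}))"
    using convex_cone_linear_image by blast
  moreover have "s * norm \<phi> + r * a \<le> norm (s *\<^sub>R \<phi> t + r *\<^sub>R y)" if "0 \<le> s" "0 \<le> r" for s r
  proof (cases "s = 0")
    case True
    have "a \<le> norm y" using t[of 1] norm_triangle_ineq[of "\<phi> t" y] attains by simp
    then show ?thesis using True that by (simp add: mult_left_mono)
  next
    case False
    then have "s * norm \<phi> + r * a = s * (norm \<phi> + (r / s) * a)" by (simp add: algebra_simps)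
    also have "\<dots> \<le> s * norm (\<phi> t + (r / s) *\<^sub>R y)"
      using that by (intro mult_left_mono t) auto
    also have "\<dots> = norm (s *\<^sub>R (\<phi> t + (r / s) *\<^sub>R y))" using that by simp
    also have "s *\<^sub>R (\<phi> t + (r / s) *\<^sub>R y) = s *\<^sub>R \<phi> t + r *\<^sub>R y"
      using False by (simp add: algebra_simps)
    finally show ?thesis .
  qed
  ultimately have "dominated_cone norm (L ` ({0..} \<times> {0..}))"
    by (auto simp: dominated_cone_def L_def)
  then obtain f where f: "f \<in> dual_ball"
    "\<And>v b. (v, b) \<in> L ` ({0..} \<times> {0..}) \<Longrightarrow> b \<le> Re (f v)"
    by (rule dual_ball_element_above_cone) blast
  have "norm \<phi> \<le> Re (f (\<phi> t))"
    by (rule f(2)) (auto simp: L_def intro!: image_eqI[of _ _ "(1, 0)"])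
  moreover have "a \<le> Re (f y)"
    by (rule f(2)) (auto simp: L_def intro!: image_eqI[of _ _ "(0, 1)"])
  ultimately show ?thesis
    using that[OF norming_valueI[OF \<open>\<phi> \<noteq> 0\<close> f(1) attains]] f(1)
    by (simp add: a_def y_def dual_ball_scaleC)
qed

text \<open>
  Point evaluations followed by norming functionals are support functionals of $\phi$ in
  $C(K,X)^*$; separation in the plane shows that their convex combinations already give every
  value at $\psi$ of a support functional.
\<close>

lemma convex_hull_norming_values:
  fixes \<phi> \<psi> :: "'k::t2_space \<Rightarrow>\<^sub>C 'x::complex_normed_vector"
  assumes K: "compact (UNIV :: 'k set)" and "\<phi> \<noteq> 0"
  shows "convex hull (norming_values \<phi> \<psi>)
    = {F \<psi> | F. F \<in> dual_ball \<and> F \<phi> = complex_of_real (norm \<phi>)}" (is "_ = ?V")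
proof
  show "convex hull (norming_values \<phi> \<psi>) \<subseteq> ?V"
  proof (rule hull_minimal)
    show "norming_values \<phi> \<psi> \<subseteq> ?V"
    proof
      fix z assume "z \<in> norming_values \<phi> \<psi>"
      then obtain t f where f: "f \<in> dual_ball" "f (\<phi> t) = complex_of_real (norm \<phi>)" "z = f (\<psi> t)"
        unfolding norming_values_def using dual_sphere_subset_dual_ball by blast
      define F where "F h = f (apply_bcontfun h t)" for h :: "'k \<Rightarrow>\<^sub>C 'x"
      have F_le: "cmod (F h) \<le> norm h" for h
        unfolding F_def using dual_ball_norm_le[OF f(1)] norm_bounded order_trans by blast
      have F_scale: "F (c *\<^sub>C h) = c * F h" for c h
        by (simp add: F_def dual_ball_scaleC[OF f(1)])
      have "bounded_linear F"
      proof (rule bounded_linear_intro[where K = 1])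
        show "F (g + h) = F g + F h" for g h
          by (simp add: F_def dual_ball_add[OF f(1)])
        show "F (r *\<^sub>R h) = r *\<^sub>R F h" for r h
          using F_scale[of "complex_of_real r" h] by (simp add: scaleC_of_real scaleR_conv_of_real)
      qed (simp add: F_le)
      then have "F \<in> dual_ball" by (simp add: dual_ball_def cdual_def F_le F_scale)
      moreover have "F \<phi> = complex_of_real (norm \<phi>)" "z = F \<psi>"
        using f(2,3) by (simp_all add: F_def)
      ultimately show "z \<in> ?V" by blast
    qed
  qed (rule convex_dual_ball_norming_values)
  show "?V \<subseteq> convex hull (norming_values \<phi> \<psi>)"
  proof (safe, rule ccontr)
    fix F :: "('k \<Rightarrow>\<^sub>C 'x) \<Rightarrow> complex"
    assume F: "F \<in> dual_ball" "F \<phi> = complex_of_real (norm \<phi>)"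
      and notin: "F \<psi> \<notin> convex hull (norming_values \<phi> \<psi>)"
    have "closed (convex hull (norming_values \<phi> \<psi>))"
      by (intro compact_imp_closed compact_convex_hull compact_norming_values K \<open>\<phi> \<noteq> 0\<close>)
    then obtain d b where d: "inner d (F \<psi>) < b"
      "\<And>x. x \<in> convex hull (norming_values \<phi> \<psi>) \<Longrightarrow> b < inner d x"
      using separating_hyperplane_closed_point[OF convex_convex_hull _ notin] by blast
    \<comment> \<open>Multiplication by \<open>- cnj d\<close> turns the inner product with \<open>d\<close> into minus a real part.\<close>
    obtain z where z: "z \<in> norming_values \<phi> \<psi>" "Re (- cnj d * F \<psi>) \<le> Re (- cnj d * z)"
      using norming_value_above[OF K \<open>\<phi> \<noteq> 0\<close> F, where c = "- cnj d" and \<psi> = \<psi>] by blast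
    have "b < inner d z" using d(2) hull_inc[OF z(1)] by blast
    then show False using z(2) d(1) by (simp add: inner_complex_def)
  qed
qed


section \<open>Approximate orthogonality in spaces of continuous functions\<close>

text \<open>
  The defining inequality $|f(u)| \ge \|f\| \|u\|$ is an equality, so dividing \<open>f\<close> by its norm and
  by the phase of $f(u)$ makes its value at \<open>u\<close> equal to $\|u\|$. Both conditions are
  invariant under nonzero scalar multiples of \<open>f\<close>.
\<close>

lemma approx_orthogonal_iff_dual_ball:
  assumes "u \<noteq> 0"
  shows "approx_orthogonal \<epsilon> u v \<longleftrightarrow>
    (\<exists>f\<in>dual_ball. f u = complex_of_real (norm u) \<and> cmod (f v) \<le> \<epsilon> * norm v)"
proof
  assume "approx_orthogonal \<epsilon> u v"
  then obtain f where f: "f \<in> cdual" "f \<noteq> (\<lambda>x. 0)" "onorm f * norm u \<le> cmod (f u)"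
    "cmod (f v) \<le> \<epsilon> * onorm f * norm v"
    unfolding approx_orthogonal_def by blast
  have bl: "bounded_linear f" and scale: "f (c *\<^sub>C x) = c * f x" for c x
    using f(1) by (auto simp: cdual_def)
  have pos: "0 < onorm f" using onorm_pos_lt[OF bl] f(2) by auto
  have fu: "cmod (f u) = onorm f * norm u" using f(3) onorm[OF bl, of u] by simp
  then have "f u \<noteq> 0" using pos assms by auto
  define c where "c = cnj (sgn (f u)) / complex_of_real (onorm f)"
  have c: "cmod c = 1 / onorm f"
    using pos \<open>f u \<noteq> 0\<close> by (simp add: c_def norm_divide norm_sgn)
  define g where "g x = c * f x" for x
  have "bounded_linear g"
    unfolding g_def by (rule bounded_linear_compose[OF bounded_linear_mult_right bl])
  moreover have "cmod (g x) \<le> norm x" for x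
    using onorm[OF bl, of x] pos by (simp add: g_def norm_mult c field_simps)
  ultimately have "g \<in> dual_ball"
    by (simp add: dual_ball_def cdual_def g_def scale)
  moreover have "g u = complex_of_real (norm u)"
    using pos cnj_sgn_mult_self[of "f u"] by (simp add: g_def c_def fu)
  moreover have "cmod (g v) \<le> \<epsilon> * norm v"
    using f(4) pos by (simp add: g_def norm_mult c field_simps)
  ultimately show "\<exists>f\<in>dual_ball. f u = complex_of_real (norm u) \<and> cmod (f v) \<le> \<epsilon> * norm v"
    by blast
next
  assume "\<exists>f\<in>dual_ball. f u = complex_of_real (norm u) \<and> cmod (f v) \<le> \<epsilon> * norm v"
  then obtain f where f: "f \<in> dual_ball" "f u = complex_of_real (norm u)" "cmod (f v) \<le> \<epsilon> * norm v"
    by blast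
  have "f \<noteq> (\<lambda>x. 0)" using f(2) assms by auto
  then show "approx_orthogonal \<epsilon> u v"
    unfolding approx_orthogonal_def using f onorm_norming[OF f(1) assms f(2)]
    by (intro bexI[of _ f]) (auto simp: dual_ball_def)
qed

theorem corollary4p3:
  fixes \<phi> \<psi> :: "'k::t2_space \<Rightarrow>\<^sub>C 'x::complex_normed_vector" and \<epsilon> :: real
  assumes "compact (UNIV :: 'k set)"
    and "\<phi> \<noteq> 0"
    and "0 \<le> \<epsilon>" and "\<epsilon> < 1"
  shows "approx_orthogonal \<epsilon> \<phi> \<psi> \<longleftrightarrow>
    (convex hull {xs (\<psi> t) | t xs. t \<in> norm_attainment_set \<phi> \<and> xs \<in> dual_sphere
        \<and> xs (\<phi> t) = complex_of_real (norm \<phi>)})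
      \<inter> cball 0 (\<epsilon> * norm \<psi>) \<noteq> {}"
  unfolding norming_values_def[symmetric] convex_hull_norming_values[OF assms(1,2)]
    approx_orthogonal_iff_dual_ball[OF assms(2)]
  by auto

end
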